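(* Let $A, E\in\mathbb{C}^{n\times n}$ with $E$ invertible and Hermitian, and let $\mathrm{ind}(A)=k$. If the $E$-weighted core-EP inverse $A^{\mathrm{ep},E}$ of $A$ exists, then $X=A^*AA^{\mathrm{ep},E}$ is the unique solution $X\in\mathbb{C}^{n\times n}$ of the system of matrix equations $$X(A^{\dagger})^*X=X,\qquad XA^k=A^*A^k,\qquad (A^{\dagger})^*X=AA^{\mathrm{ep},E}.$$
   Context: $A^*$ is the conjugate transpose of $A$ and $A^\dagger$ is the (ordinary) Moore-Penrose inverse of $A$. The index $\mathrm{ind}(A)$ is the smallest non-negative integer $k$ with $\mathrm{rank}(A^k)=\mathrm{rank}(A^{k+1})$ (with $A^0=I$). For $\mathrm{ind}(A)=k$ and $E$ invertible Hermitian, a matrix $X\in\mathbb{C}^{n\times n}$ is called the $E$-weighted core-EP inverse of $A$, denoted $A^{\mathrm{ep},E}$, if $XA^{k+1}=A^k$, $AX^2=X$, and $(EAX)^*=EAX$; such an $X$ is unique when it exists. *)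

theory Defs
  imports
    "Jordan_Normal_Form.DL_Rank"
    "Jordan_Normal_Form.Schur_Decomposition"
begin

text \<open>The conjugate transpose is \<^const>\<open>mat_adjoint\<close>.\<close>

definition hermitian_mat :: "complex mat \<Rightarrow> bool" where
  "hermitian_mat A \<longleftrightarrow> mat_adjoint A = A"

text \<open>Meaningful for square matrices only; \<open>A ^\<^sub>m 0\<close> is the identity matrix.\<close>

definition mat_index :: "complex mat \<Rightarrow> nat" where
  "mat_index A =
     (LEAST k. vec_space.rank (dim_row A) (A ^\<^sub>m k) = vec_space.rank (dim_row A) (A ^\<^sub>m (k + 1)))"

text \<open>The four Penrose equations.\<close>

definition is_moore_penrose :: "complex mat \<Rightarrow> complex mat \<Rightarrow> bool" where
  "is_moore_penrose A X \<longleftrightarrow>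
     X \<in> carrier_mat (dim_col A) (dim_row A) \<and>
     A * X * A = A \<and>
     X * A * X = X \<and>
     mat_adjoint (A * X) = A * X \<and>
     mat_adjoint (X * A) = X * A"

definition moore_penrose :: "complex mat \<Rightarrow> complex mat" where
  "moore_penrose A = (THE X. is_moore_penrose A X)"

text \<open>
  The notion is meant for square \<open>A\<close> and for \<open>E\<close> invertible and Hermitian of the same size.
\<close>

definition is_weighted_core_ep :: "complex mat \<Rightarrow> complex mat \<Rightarrow> complex mat \<Rightarrow> bool" where
  "is_weighted_core_ep E A X \<longleftrightarrow>
     X \<in> carrier_mat (dim_row A) (dim_row A) \<and>
     X * A ^\<^sub>m (mat_index A + 1) = A ^\<^sub>m mat_index A \<and>
     A * X ^\<^sub>m 2 = X \<and>
     mat_adjoint (E * A * X) = E * A * X"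

text \<open>Unspecified when no such matrix exists.\<close>

definition weighted_core_ep :: "complex mat \<Rightarrow> complex mat \<Rightarrow> complex mat" where
  "weighted_core_ep E A = (THE X. is_weighted_core_ep E A X)"

end

theory Submission
  imports Defs
begin

text \<open>
  Write \<open>W\<close> for the weighted core-EP inverse and \<open>M\<close> for the Moore-Penrose inverse. From
  \<open>W = A W\<^sup>2\<close> one gets \<open>W = A\<^sup>k Z\<close> for some \<open>Z\<close>, and then \<open>W A\<^sup>k\<^sup>+\<^sup>1 = A\<^sup>k\<close> gives \<open>W A W = W\<close>.
  Together with \<open>M\<^sup>* A\<^sup>* A = A\<close> this shows that \<open>A\<^sup>* A W\<close> solves the system. Conversely every
  solution satisfies \<open>X = X M\<^sup>* X = X A W = X A\<^sup>k (A Z) = A\<^sup>* A\<^sup>k (A Z) = A\<^sup>* A W\<close>.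

  The Moore-Penrose inverse is obtained as \<open>R A L\<close> from a \<open>{1,3}\<close>-inverse \<open>L\<close> and a
  \<open>{1,4}\<close>-inverse \<open>R\<close> of \<open>A\<close>, which in turn come from inner inverses of \<open>A\<^sup>* A\<close> and \<open>A A\<^sup>*\<close>.
\<close>

section \<open>Matrix algebra with dimension side conditions\<close>

text \<open>
  The library versions have carrier premises with schematic dimensions, which the simplifier often
  cannot instantiate for compound factors; the equations between dimensions below have none.
\<close>

lemma mult_mat_assoc_dim:
  fixes A :: "'a :: semiring_0 mat"
  assumes "dim_col A = dim_row B" "dim_col B = dim_row C"
  shows "A * B * C = A * (B * C)"
  using assms by (intro assoc_mult_mat[of A "dim_row A" "dim_row B" B "dim_row C" C "dim_col C"]) auto

lemma mult_mat_minus_dim: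
  fixes A :: "'a :: ring mat"
  assumes "dim_col A = dim_row B" "dim_row B = dim_row C" "dim_col B = dim_col C"
  shows "A * (B - C) = A * B - A * C"
  using assms
  by (intro mult_minus_distrib_mat[of A "dim_row A" "dim_row B" B "dim_col B" C]) auto

lemma minus_mult_mat_dim:
  fixes A :: "'a :: ring mat"
  assumes "dim_col A = dim_row C" "dim_row A = dim_row B" "dim_col A = dim_col B"
  shows "(A - B) * C = A * C - B * C"
  using assms
  by (intro minus_mult_distrib_mat[of A "dim_row A" "dim_col A" B C "dim_col C"]) auto

lemma mult_mat_plus_dim:
  fixes A :: "'a :: semiring_0 mat"
  assumes "dim_col A = dim_row B" "dim_row B = dim_row C" "dim_col B = dim_col C"
  shows "A * (B + C) = A * B + A * C"
  using assms
  by (intro mult_add_distrib_mat[of A "dim_row A" "dim_row B" B "dim_col B" C]) auto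

lemma plus_mult_mat_dim:
  fixes A :: "'a :: semiring_0 mat"
  assumes "dim_col A = dim_row C" "dim_row A = dim_row B" "dim_col A = dim_col B"
  shows "(A + B) * C = A * C + B * C"
  using assms
  by (intro add_mult_distrib_mat[of A "dim_row A" "dim_col A" B C "dim_col C"]) auto

section \<open>The conjugate transpose and left cancellation of Gram matrices\<close>

lemma mat_adjoint_dim [simp]:
  "dim_row (mat_adjoint A) = dim_col A" "dim_col (mat_adjoint A) = dim_row A"
  by (simp_all add: mat_adjoint_def)

lemma mat_adjoint_index:
  assumes "i < dim_col A" "j < dim_row A"
  shows "mat_adjoint A $$ (i, j) = conjugate (A $$ (j, i))"
  using assms by (simp add: mat_adjoint_def mat_of_rows_def)

lemma mat_adjoint_adjoint [simp]: "mat_adjoint (mat_adjoint A) = A"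
  by (rule eq_matI) (simp_all add: mat_adjoint_index)

lemma mat_adjoint_mult:
  fixes A B :: "complex mat"
  assumes "dim_col A = dim_row B"
  shows "mat_adjoint (A * B) = mat_adjoint B * mat_adjoint A"
proof (rule eq_matI)
  fix i j assume "i < dim_row (mat_adjoint B * mat_adjoint A)"
    and "j < dim_col (mat_adjoint B * mat_adjoint A)"
  then show "mat_adjoint (A * B) $$ (i, j) = (mat_adjoint B * mat_adjoint A) $$ (i, j)"
    using assms
    by (auto simp: mat_adjoint_index scalar_prod_def sum_conjugate mult.commute intro!: sum.cong)
qed simp_all

text \<open>The diagonal entries of the Gram matrix are the squared norms of the columns of
  \<open>A\<close>.\<close>

lemma mat_adjoint_mult_self_eq_0:
  fixes A :: "complex mat"
  assumes "mat_adjoint A * A = 0\<^sub>m (dim_col A) (dim_col A)"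
  shows "A = 0\<^sub>m (dim_row A) (dim_col A)"
proof (rule eq_matI)
  fix i j assume ij: "i < dim_row (0\<^sub>m (dim_row A) (dim_col A))"
    "j < dim_col (0\<^sub>m (dim_row A) (dim_col A))"
  have "(mat_adjoint A * A) $$ (j, j) = conjugate (col A j) \<bullet> col A j"
    using ij by (simp add: mat_adjoint_def)
  then have "conjugate (col A j) \<bullet> col A j = 0"
    using ij assms by simp
  then have "col A j \<bullet>c col A j = 0"
    by (simp add: scalar_prod_def mult.commute)
  then have "col A j = 0\<^sub>v (dim_row A)"
    by (subst (asm) conjugate_square_eq_0_vec[of _ "dim_row A"]) auto
  then have "col A j $ i = 0" using ij by simp
  then show "A $$ (i, j) = 0\<^sub>m (dim_row A) (dim_col A) $$ (i, j)"
    using ij by simp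
qed simp_all

text \<open>The hypothesis makes the Gram matrix of \<open>A * (B - C)\<close> vanish. This serves
  to cancel a left factor \<open>mat_adjoint A\<close>.\<close>

lemma mult_mat_eq_from_gram:
  fixes A B C :: "complex mat"
  assumes A: "A \<in> carrier_mat m n" and B: "B \<in> carrier_mat n p" and C: "C \<in> carrier_mat n p"
    and eq: "mat_adjoint A * A * B = mat_adjoint A * A * C"
  shows "A * B = A * C"
proof -
  let ?D = "A * (B - C)"
  have "mat_adjoint A * A * (B - C) = 0\<^sub>m n p"
    using A B C by (simp add: mult_mat_minus_dim eq) (intro eq_matI, auto)
  then have "mat_adjoint ?D * ?D = mat_adjoint (B - C) * 0\<^sub>m n p"
    using A B C by (simp add: mat_adjoint_mult mult_mat_assoc_dim)
  then have "mat_adjoint ?D * ?D = 0\<^sub>m p p"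
    using B C by simp
  then have "?D = 0\<^sub>m m p"
    using mat_adjoint_mult_self_eq_0[of ?D] A B C by simp
  then have D0: "A * B - A * C = 0\<^sub>m m p"
    using A B C by (simp add: mult_mat_minus_dim)
  show ?thesis
  proof (rule eq_matI)
    fix i j assume ij: "i < dim_row (A * C)" "j < dim_col (A * C)"
    then have "(A * B - A * C) $$ (i, j) = 0"
      using A C by (subst D0) simp
    then show "(A * B) $$ (i, j) = (A * C) $$ (i, j)"
      using ij A B C by simp
  qed (use A B C in auto)
qed

section \<open>Existence and uniqueness of the Moore-Penrose inverse\<close>

text \<open>
  Wedderburn rank reduction: for an entry \<open>a = A\<^sub>i\<^sub>j \<noteq> 0\<close> and \<open>N = a\<^sup>-\<^sup>1 e\<^sub>j e\<^sub>i\<^sup>T\<close>, the matrix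
  \<open>A' = A - A N A\<close> has fewer nonzero rows than \<open>A\<close>, and an inner inverse \<open>G'\<close> of \<open>A'\<close> yields
  the inner inverse \<open>N + (1 - N A) G' (1 - A N)\<close> of \<open>A\<close>.
\<close>

lemma inner_inverse_exists:
  fixes A :: "'a :: field mat"
  assumes "A \<in> carrier_mat m n"
  shows "\<exists>G \<in> carrier_mat n m. A * G * A = A"
  using assms
proof (induction "card {i. i < m \<and> (\<exists>j<n. A $$ (i, j) \<noteq> 0)}" arbitrary: A rule: less_induct)
  case less
  note A = less.prems
  show ?case
  proof (cases "\<exists>i<m. \<exists>j<n. A $$ (i, j) \<noteq> 0")
    case False
    then have "A = 0\<^sub>m m n"
      using A by (intro eq_matI) auto
    then show ?thesis
      by (intro bexI[of _ "0\<^sub>m n m"]) auto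
  next
    case True
    then obtain i j where ij: "i < m" "j < n" and a: "A $$ (i, j) \<noteq> 0" by blast
    define N where "N = mat n m (\<lambda>(p, q). if p = j \<and> q = i then inverse (A $$ (i, j)) else 0)"
    have N: "N \<in> carrier_mat n m" by (simp add: N_def)
    define A' where "A' = A - A * N * A"
    have A': "A' \<in> carrier_mat m n" using A N unfolding A'_def by (intro carrier_matI) auto
    have AN: "(A * N) $$ (p, q) = (if q = i then A $$ (p, j) * inverse (A $$ (i, j)) else 0)"
      if "p < m" "q < m" for p q
    proof -
      have "(A * N) $$ (p, q) = (\<Sum>r\<in>{0..<n}. A $$ (p, r) * N $$ (r, q))"
        using that A N by (auto simp: scalar_prod_def intro!: sum.cong)
      also have "\<dots> =
          (\<Sum>r\<in>{0..<n}. if r = j then (if q = i then A $$ (p, j) * inverse (A $$ (i, j)) else 0) else 0)"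
        using that by (intro sum.cong) (auto simp: N_def)
      finally show ?thesis using ij by simp
    qed
    have A'_entry: "A' $$ (p, q) = A $$ (p, q) - A $$ (p, j) * inverse (A $$ (i, j)) * A $$ (i, q)"
      if "p < m" "q < n" for p q
    proof -
      have "(A * N * A) $$ (p, q) = (\<Sum>r\<in>{0..<m}. (A * N) $$ (p, r) * A $$ (r, q))"
        using that A N by (auto simp: scalar_prod_def simp del: assoc_mult_mat intro!: sum.cong)
      also have "\<dots> = (\<Sum>r\<in>{0..<m}. if r = i then
          A $$ (p, j) * inverse (A $$ (i, j)) * A $$ (i, q) else 0)"
        using that by (intro sum.cong) (auto simp: AN)
      finally show ?thesis
        using that A N ij by (simp add: A'_def del: assoc_mult_mat)
    qed
    let ?R = "\<lambda>A :: 'a mat. {i. i < m \<and> (\<exists>j<n. A $$ (i, j) \<noteq> 0)}"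
    \<comment> \<open>Row \<open>p\<close> of \<open>A'\<close> is row \<open>p\<close> of
      \<open>A\<close> minus \<open>A $$ (p, j) / A $$ (i, j)\<close> times row \<open>i\<close>. So
      zero rows stay zero, and row \<open>i\<close> becomes zero.\<close>
    have "?R A' \<subseteq> ?R A"
    proof (intro subsetI CollectI conjI; elim CollectE conjE exE)
      fix p q assume p: "p < m" and q: "q < n" and nz: "A' $$ (p, q) \<noteq> 0"
      show "\<exists>j<n. A $$ (p, j) \<noteq> 0"
      proof (rule ccontr)
        assume "\<not> (\<exists>j<n. A $$ (p, j) \<noteq> 0)"
        then have "A $$ (p, q) = 0" "A $$ (p, j) = 0" using q ij by blast+
        then show False using nz p q by (simp add: A'_entry)
      qed
    qed
    moreover have "i \<in> ?R A" using ij a by blast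
    moreover have "i \<notin> ?R A'" using ij a by (auto simp: A'_entry)
    ultimately have "?R A' \<subset> ?R A" by blast
    then have "card (?R A') < card (?R A)"
      by (intro psubset_card_mono) auto
    from less.hyps[OF this A'] obtain G' where G': "G' \<in> carrier_mat n m" "A' * G' * A' = A'"
      by blast
    define L where "L = 1\<^sub>m n - N * A"
    define R where "R = 1\<^sub>m m - A * N"
    have L: "L \<in> carrier_mat n n" and R: "R \<in> carrier_mat m m"
      using A N by (auto simp: L_def R_def)
    have AL: "A * L = A'" and RA: "R * A = A'"
      using A N by (simp_all add: L_def R_def A'_def mult_mat_minus_dim minus_mult_mat_dim mult_mat_assoc_dim)
    have "A * (N + L * G' * R) * A = A * N * A + A * L * G' * (R * A)"
      using A N L R G'(1) by (simp add: mult_mat_plus_dim plus_mult_mat_dim mult_mat_assoc_dim)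
    also have "\<dots> = A * N * A + A'"
      by (simp add: AL RA G'(2))
    also have "\<dots> = A"
      using A N by (intro eq_matI) (auto simp: A'_def)
    finally show ?thesis
      using N L R G'(1) by (intro bexI[of _ "N + L * G' * R"]) auto
  qed
qed

lemma inverse_13_exists:
  fixes A :: "complex mat"
  assumes A: "A \<in> carrier_mat m n"
  shows "\<exists>L \<in> carrier_mat n m. A * L * A = A \<and> mat_adjoint (A * L) = A * L"
proof -
  let ?H = "mat_adjoint A * A"
  have "?H \<in> carrier_mat n n" using A by auto
  from inner_inverse_exists[OF this] obtain G where
    G: "G \<in> carrier_mat n n" and HGH: "?H * G * ?H = ?H" by blast
  define P where "P = A * G * mat_adjoint A"
  have P: "P \<in> carrier_mat m m" using A G by (auto simp: P_def)
  \<comment> \<open>Cancels the leading \<open>mat_adjoint A\<close> in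
    \<open>?H * G * ?H = ?H\<close>.\<close>
  have "A * (G * ?H) = A * 1\<^sub>m n"
    using A G HGH by (intro mult_mat_eq_from_gram[of A m n _ n]) (auto simp: mult_mat_assoc_dim)
  then have PA: "P * A = A"
    using A G by (simp add: P_def mult_mat_assoc_dim)
  have adj: "mat_adjoint P = A * (mat_adjoint G * mat_adjoint A)"
    using A G by (simp add: P_def mat_adjoint_mult mult_mat_assoc_dim)
  \<comment> \<open>\<open>G\<close> need not be Hermitian, but \<open>mat_adjoint P\<close> has
    \<open>A\<close> as its left factor, so \<open>P\<close> fixes it. Thus
    \<open>mat_adjoint P\<close> equals the Hermitian matrix
    \<open>P * mat_adjoint P\<close>.\<close>
  have "P * mat_adjoint P = P * A * (mat_adjoint G * mat_adjoint A)"
    unfolding adj using A G P by (simp add: mult_mat_assoc_dim)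
  then have PP: "P * mat_adjoint P = mat_adjoint P"
    by (simp add: PA adj)
  then have "mat_adjoint (P * mat_adjoint P) = P"
    by simp
  moreover have "mat_adjoint (P * mat_adjoint P) = P * mat_adjoint P"
    by (simp add: mat_adjoint_mult)
  ultimately have "mat_adjoint P = P"
    using PP by simp
  then show ?thesis
    using A G PA
    by (intro bexI[of _ "G * mat_adjoint A"]) (auto simp: P_def mult_mat_assoc_dim)
qed

lemma is_moore_penrose_exists: "\<exists>X. is_moore_penrose A X"
proof -
  define m n where "m = dim_row A" and "n = dim_col A"
  have A: "A \<in> carrier_mat m n" by (simp add: m_def n_def)
  obtain L where L: "L \<in> carrier_mat n m" "A * L * A = A" "mat_adjoint (A * L) = A * L"
    using inverse_13_exists[OF A] by blast
  have "mat_adjoint A \<in> carrier_mat n m" using A by auto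
  from inverse_13_exists[OF this] obtain K where K: "K \<in> carrier_mat m n"
    "mat_adjoint A * K * mat_adjoint A = mat_adjoint A"
    "mat_adjoint (mat_adjoint A * K) = mat_adjoint A * K"
    by blast
  \<comment> \<open>The adjoint of a {1,3}-inverse of \<open>mat_adjoint A\<close> is a
    {1,4}-inverse of \<open>A\<close>.\<close>
  define R where "R = mat_adjoint K"
  have R: "R \<in> carrier_mat n m" using K by (auto simp: R_def)
  have RA: "R * A = mat_adjoint A * K"
    using K A by (simp add: R_def mat_adjoint_mult)
  have "mat_adjoint (mat_adjoint A * K * mat_adjoint A) = A * (R * A)"
    using K(1) A by (simp add: R_def mat_adjoint_mult)
  then have ARA: "A * (R * A) = A"
    by (simp add: K(2))
  have ALA: "A * (L * A) = A"
    using L(1,2) A by (simp add: mult_mat_assoc_dim)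
  let ?X = "R * A * L"
  have "A * ?X = A * (R * A) * L" "?X * A = R * (A * (L * A))"
    using A L(1) R by (simp_all add: mult_mat_assoc_dim)
  then have AX: "A * ?X = A * L" and XA: "?X * A = R * A"
    by (simp_all only: ARA ALA)
  have "?X * A * ?X = R * (A * (R * A)) * L"
    unfolding XA using A L(1) R by (simp add: mult_mat_assoc_dim)
  then have "?X * A * ?X = ?X" by (simp only: ARA)
  moreover have "mat_adjoint (?X * A) = ?X * A"
    unfolding XA using K(3) by (simp only: RA)
  moreover have "A * ?X * A = A"
    unfolding AX by (rule L(2))
  moreover have "mat_adjoint (A * ?X) = A * ?X"
    unfolding AX by (rule L(3))
  moreover have "?X \<in> carrier_mat (dim_col A) (dim_row A)"
    using A R L(1) by (intro carrier_matI) auto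
  ultimately have "is_moore_penrose A ?X"
    unfolding is_moore_penrose_def by blast
  then show ?thesis by blast
qed

text \<open>Penrose's argument: inserting \<open>A = A * Y * A\<close> and exchanging Hermitian
  factors by taking adjoints gives \<open>A * X = A * Y\<close> and
  \<open>X * A = Y * A\<close>.\<close>

lemma is_moore_penrose_unique:
  assumes "is_moore_penrose A X" "is_moore_penrose A Y"
  shows "X = Y"
proof -
  note X = assms(1)[unfolded is_moore_penrose_def]
  note Y = assms(2)[unfolded is_moore_penrose_def]
  have d [simp]: "dim_row X = dim_col A" "dim_col X = dim_row A"
    "dim_row Y = dim_col A" "dim_col Y = dim_row A" using X Y by auto
  have "A * X = mat_adjoint (A * Y * A * X)"
    using X Y by simp
  also have "\<dots> = mat_adjoint (A * Y * (A * X))"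
    by (simp add: mult_mat_assoc_dim)
  also have "\<dots> = mat_adjoint (A * X) * mat_adjoint (A * Y)"
    by (rule mat_adjoint_mult) simp
  also have "\<dots> = A * X * (A * Y)"
    using X Y by simp
  also have "\<dots> = A * X * A * Y"
    by (simp add: mult_mat_assoc_dim)
  finally have 1: "A * X = A * Y" using X by simp
  have "X * A = mat_adjoint (X * (A * Y * A))"
    using X Y by simp
  also have "\<dots> = mat_adjoint (X * A * (Y * A))"
    by (simp add: mult_mat_assoc_dim)
  also have "\<dots> = mat_adjoint (Y * A) * mat_adjoint (X * A)"
    by (rule mat_adjoint_mult) simp
  also have "\<dots> = Y * A * (X * A)"
    using X Y by simp
  also have "\<dots> = Y * (A * X * A)"
    by (simp add: mult_mat_assoc_dim)
  finally have 2: "X * A = Y * A" using X by simp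
  have "X = X * A * X" using X by simp
  also have "\<dots> = Y * (A * X)" by (simp add: 2 mult_mat_assoc_dim)
  also have "\<dots> = Y * A * Y" by (simp add: 1 mult_mat_assoc_dim)
  also have "\<dots> = Y" using Y by simp
  finally show ?thesis .
qed

lemma moore_penrose_is_moore_penrose: "is_moore_penrose A (moore_penrose A)"
  unfolding moore_penrose_def
  using is_moore_penrose_exists is_moore_penrose_unique by (metis theI)

text \<open>The first two factors combine to the adjoint of \<open>A * moore_penrose A\<close>,
  which is Hermitian, and the first Penrose equation finishes.\<close>

lemma adjoint_moore_penrose_mult_adjoint_mult:
  "mat_adjoint (moore_penrose A) * (mat_adjoint A * A) = A"
proof -
  let ?M = "moore_penrose A"
  note M = moore_penrose_is_moore_penrose[of A, unfolded is_moore_penrose_def]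
  have d: "dim_row ?M = dim_col A" "dim_col ?M = dim_row A" using M by auto
  have "mat_adjoint ?M * (mat_adjoint A * A) = mat_adjoint (A * ?M) * A"
    by (simp add: d mat_adjoint_mult mult_mat_assoc_dim)
  then show ?thesis using M by simp
qed

section \<open>The weighted core-EP inverse\<close>

lemma pow_mat_Suc_left:
  fixes A :: "'a :: semiring_1 mat"
  assumes "A \<in> carrier_mat n n"
  shows "A ^\<^sub>m Suc k = A * A ^\<^sub>m k"
proof (induction k)
  case (Suc k)
  have "A ^\<^sub>m Suc (Suc k) = A * A ^\<^sub>m k * A"
    using Suc by simp
  then show ?case
    using assms by (simp add: mult_mat_assoc_dim)
qed (use assms in simp)

text \<open>Substituting \<open>X = A ^\<^sub>m k * Z\<close> for the first \<open>X\<close> in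
  \<open>A * (X * X)\<close> gains one more factor \<open>A\<close>. So the range of
  \<open>X\<close> lies in that of every power of \<open>A\<close>.\<close>

lemma right_factor_pow:
  fixes A X :: "'a :: semiring_1 mat"
  assumes A: "A \<in> carrier_mat n n" and X: "X \<in> carrier_mat n n" and AXX: "A * (X * X) = X"
  shows "\<exists>Z \<in> carrier_mat n n. X = A ^\<^sub>m k * Z"
proof (induction k)
  case 0
  then show ?case using A X by (intro bexI[of _ X]) auto
next
  case (Suc k)
  then obtain Z where Z: "Z \<in> carrier_mat n n" "X = A ^\<^sub>m k * Z" by blast
  have "X = A * (A ^\<^sub>m k * Z * X)" using AXX Z(2) by simp
  also have "\<dots> = A ^\<^sub>m Suc k * (Z * X)"
    unfolding pow_mat_Suc_left[OF A] using A X Z(1) by (simp add: mult_mat_assoc_dim)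
  finally show ?case using X Z(1) by (intro bexI[of _ "Z * X"]) auto
qed

lemma is_weighted_core_epD:
  assumes A: "A \<in> carrier_mat n n" and E: "E \<in> carrier_mat n n"
    and X: "is_weighted_core_ep E A X"
  shows "X \<in> carrier_mat n n" "X * (A * A ^\<^sub>m mat_index A) = A ^\<^sub>m mat_index A"
    "A * (X * X) = X" "mat_adjoint (E * (A * X)) = E * (A * X)"
proof -
  show Xc: "X \<in> carrier_mat n n" using A X by (simp add: is_weighted_core_ep_def)
  show "X * (A * A ^\<^sub>m mat_index A) = A ^\<^sub>m mat_index A"
    using X unfolding is_weighted_core_ep_def Suc_eq_plus1[symmetric] pow_mat_Suc_left[OF A] by blast
  show "A * (X * X) = X"
    using X Xc by (simp add: is_weighted_core_ep_def numeral_2_eq_2)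
  show "mat_adjoint (E * (A * X)) = E * (A * X)"
    using X A E Xc by (simp add: is_weighted_core_ep_def mult_mat_assoc_dim)
qed

text \<open>Writing \<open>Y = A ^\<^sub>m k * Z\<close> reduces the claim to the equation for
  \<open>X\<close>. Distinct \<open>X\<close> and \<open>Y\<close> serve the uniqueness proof;
  \<open>X = Y\<close> gives the outer inverse property.\<close>

lemma core_ep_mult_absorb:
  fixes A X Y :: "'a :: semiring_1 mat"
  assumes A: "A \<in> carrier_mat n n" and X: "X \<in> carrier_mat n n" and Y: "Y \<in> carrier_mat n n"
    and XA: "X * (A * A ^\<^sub>m k) = A ^\<^sub>m k" and AYY: "A * (Y * Y) = Y"
  shows "X * (A * Y) = Y"
proof -
  obtain Z where Z: "Z \<in> carrier_mat n n" "Y = A ^\<^sub>m k * Z"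
    using right_factor_pow[OF A Y AYY] by blast
  have "X * (A * Y) = X * (A * A ^\<^sub>m k) * Z"
    using A X Z by (simp add: mult_mat_assoc_dim)
  then show ?thesis by (simp only: XA Z(2))
qed

text \<open>
  \<open>P = A X\<close> and \<open>Q = A Y\<close> are projections with the same range that are both self-adjoint for the
  form given by \<open>E\<close>, hence equal.
\<close>

lemma is_weighted_core_ep_unique:
  assumes A: "A \<in> carrier_mat n n" and E: "E \<in> carrier_mat n n"
    and inv: "invertible_mat E" and herm: "hermitian_mat E"
    and "is_weighted_core_ep E A X" "is_weighted_core_ep E A Y"
  shows "X = Y"
proof -
  note X = is_weighted_core_epD[OF A E assms(5)]
  note Y = is_weighted_core_epD[OF A E assms(6)]
  define P Q where "P = A * X" and "Q = A * Y"
  have P: "P \<in> carrier_mat n n" and Q: "Q \<in> carrier_mat n n"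
    using A X(1) Y(1) by (auto simp: P_def Q_def)
  have XQ: "X * Q = Y" and YP: "Y * P = X" and XP: "X * P = X"
    unfolding P_def Q_def
    using core_ep_mult_absorb[OF A X(1) Y(1) X(2) Y(3)]
      core_ep_mult_absorb[OF A Y(1) X(1) Y(2) X(3)]
      core_ep_mult_absorb[OF A X(1) X(1) X(2) X(3)] .
  have "P * Q = A * (X * Q)" "Q * P = A * (Y * P)"
    using A X(1) Y(1) P Q by (simp_all add: P_def Q_def mult_mat_assoc_dim)
  then have PQ: "P * Q = Q" and QP: "Q * P = P"
    by (simp_all only: XQ YP) (simp_all only: P_def Q_def)
  have EP: "mat_adjoint (E * P) = E * P" and EQ: "mat_adjoint (E * Q) = E * Q"
    using X(4) Y(4) by (simp_all add: P_def Q_def)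
  have E': "mat_adjoint E = E" using herm by (simp add: hermitian_mat_def)
  have PE: "mat_adjoint P * E = E * P"
    using EP E E' P by (simp add: mat_adjoint_mult)
  \<comment> \<open>Replaces \<open>P\<close> by \<open>Q * P\<close>, then takes adjoints to
    reverse the order of the projections, since \<open>P * Q\<close> is \<open>Q\<close>.\<close>
  have "E * P = mat_adjoint (E * Q * P)"
    using E P Q EP by (simp add: QP mult_mat_assoc_dim)
  also have "\<dots> = mat_adjoint P * (E * Q)"
    using E P Q by (subst mat_adjoint_mult) (simp_all add: EQ)
  also have "\<dots> = mat_adjoint P * E * Q"
    using E P Q by (simp add: mult_mat_assoc_dim)
  also have "\<dots> = E * (P * Q)"
    unfolding PE using E P Q by (simp add: mult_mat_assoc_dim)
  finally have EPQ: "E * P = E * Q" by (simp only: PQ)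
  obtain F where F: "E * F = 1\<^sub>m (dim_row E)" "F * E = 1\<^sub>m (dim_row F)"
    using inv by (auto simp: invertible_mat_def inverts_mat_def)
  \<comment> \<open>\<open>invertible_mat\<close> leaves the size of the inverse open; the two
    identity matrices determine it.\<close>
  have "dim_col F = n" "dim_row F = n"
    using arg_cong[OF F(1), of dim_col] arg_cong[OF F(2), of dim_col] E by auto
  then have Fd: "F \<in> carrier_mat n n" by auto
  have "F * E * P = F * E * Q"
    using E Fd P Q EPQ by (simp add: mult_mat_assoc_dim)
  then have "P = Q"
    using F(2) Fd P Q by simp
  then show ?thesis using XP XQ by simp
qed

lemma weighted_core_ep_is_weighted_core_ep:
  assumes "A \<in> carrier_mat n n" "E \<in> carrier_mat n n" "invertible_mat E" "hermitian_mat E"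
    and "\<exists>Y. is_weighted_core_ep E A Y"
  shows "is_weighted_core_ep E A (weighted_core_ep E A)"
  unfolding weighted_core_ep_def
  using assms(5) is_weighted_core_ep_unique[OF assms(1-4)] by (metis theI)

theorem theorem4p1:
  fixes A E :: "complex mat" and n k :: nat
  assumes "A \<in> carrier_mat n n" and "E \<in> carrier_mat n n"
    and "invertible_mat E" and "hermitian_mat E"
    and "mat_index A = k"
    and "\<exists>Y. is_weighted_core_ep E A Y"
  shows "{X \<in> carrier_mat n n.
            X * mat_adjoint (moore_penrose A) * X = X \<and>
            X * A ^\<^sub>m k = mat_adjoint A * A ^\<^sub>m k \<and>
            mat_adjoint (moore_penrose A) * X = A * weighted_core_ep E A}
         = {mat_adjoint A * A * weighted_core_ep E A}"
proof -
  note A = assms(1)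
  define W where "W = weighted_core_ep E A"
  define M where "M = mat_adjoint (moore_penrose A)"
  have "is_weighted_core_ep E A W"
    unfolding W_def by (rule weighted_core_ep_is_weighted_core_ep) fact+
  note W = is_weighted_core_epD[OF assms(1,2) this, unfolded assms(5)]
  have M: "M \<in> carrier_mat n n"
    using moore_penrose_is_moore_penrose[of A] A by (auto simp: M_def is_moore_penrose_def)
  have MAA: "M * (mat_adjoint A * A) = A"
    unfolding M_def by (rule adjoint_moore_penrose_mult_adjoint_mult)
  have WAW: "W * (A * W) = W"
    using core_ep_mult_absorb[OF A W(1) W(1) W(2) W(3)] .
  obtain Z where Z: "Z \<in> carrier_mat n n" "W = A ^\<^sub>m k * Z"
    using right_factor_pow[OF A W(1) W(3)] by blast
  \<comment> \<open>With \<open>A ^\<^sub>m k\<close> in front, the second equation of the system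
    applies to \<open>X * (A * W)\<close>.\<close>
  have AW: "A * W = A ^\<^sub>m k * (A * Z)"
  proof -
    have "A * W = A ^\<^sub>m Suc k * Z"
      unfolding pow_mat_Suc_left[OF A] Z(2) using A Z(1) by (simp add: mult_mat_assoc_dim)
    then show ?thesis using A Z(1) by (simp add: mult_mat_assoc_dim)
  qed
  let ?S = "mat_adjoint A * A * W"
  have S: "?S \<in> carrier_mat n n" using A W(1) by auto
  have "M * ?S = M * (mat_adjoint A * A) * W"
    using A W(1) M by (simp add: mult_mat_assoc_dim)
  then have MS: "M * ?S = A * W" by (simp only: MAA)
  have "?S * M * ?S = ?S * (M * ?S)"
    using S M by (intro assoc_mult_mat[of _ n n _ n _ n]) auto
  also have "\<dots> = mat_adjoint A * (A * (W * (A * W)))"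
    unfolding MS using A W(1) by (simp add: mult_mat_assoc_dim)
  finally have SMS: "?S * M * ?S = ?S"
    using A W(1) by (simp add: WAW mult_mat_assoc_dim)
  \<comment> \<open>\<open>A * W\<close> fixes the range of \<open>A ^\<^sub>m k\<close>: expanding
    \<open>A ^\<^sub>m k\<close> by the first defining equation of \<open>W\<close> creates the
    square that \<open>A * (W * W) = W\<close> absorbs.\<close>
  have AWA: "A * (W * A ^\<^sub>m k) = A ^\<^sub>m k"
  proof -
    have "A * (W * A ^\<^sub>m k) = A * (W * (W * (A * A ^\<^sub>m k)))"
      by (simp only: W(2))
    also have "\<dots> = A * (W * W) * (A * A ^\<^sub>m k)"
      using A W(1) by (simp add: mult_mat_assoc_dim)
    finally show ?thesis by (simp only: W(2,3))
  qed
  have SA: "?S * A ^\<^sub>m k = mat_adjoint A * A ^\<^sub>m k"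
    using A W(1) by (simp add: mult_mat_assoc_dim AWA)
  have "X = ?S"
    if X: "X \<in> carrier_mat n n" and XMX: "X * M * X = X"
      and XA: "X * A ^\<^sub>m k = mat_adjoint A * A ^\<^sub>m k" and MX: "M * X = A * W" for X
  proof -
    have "X = X * (M * X)"
      using XMX X M by (simp add: mult_mat_assoc_dim)
    also have "\<dots> = X * A ^\<^sub>m k * (A * Z)"
      unfolding MX AW using X A Z(1) by (simp add: mult_mat_assoc_dim)
    also have "\<dots> = mat_adjoint A * (A ^\<^sub>m k * (A * Z))"
      unfolding XA using A Z(1) by (simp add: mult_mat_assoc_dim)
    also have "\<dots> = ?S"
      unfolding AW[symmetric] using A W(1) by (simp add: mult_mat_assoc_dim)
    finally show ?thesis .
  qed
  then show ?thesis
    unfolding W_def[symmetric] M_def[symmetric] using S SMS SA MS by blast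
qed

end
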